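(* If $M$ is a square-tiled lattice surface, then the set $S_M\subset\mathbb{R}^2$ of holonomy vectors of all saddle connections of $M$ is not relatively dense in $\mathbb{R}^2$.
   Context: A translation surface $M$ is a compact connected oriented surface with a finite set $\Sigma$ of singular points, equipped on $M\setminus\Sigma$ with an atlas whose transition maps are translations of $\mathbb{R}^2$, the points of $\Sigma$ being cone points of angle $2\pi k$ with integer $k\ge 2$; in the case of a flat torus (no cone points), $\Sigma$ is taken to consist of a single marked point. A saddle connection is a straight (geodesic) segment on $M$ whose endpoints lie in $\Sigma$ (possibly equal) and whose interior contains no point of $\Sigma$; its holonomy vector is the vector in $\mathbb{R}^2$ obtained by developing the (oriented) segment in the translation charts. $S_M\subset\mathbb{R}^2$ denotes the set of holonomy vectors of all saddle connections of $M$ (with both orientations). $M$ is a lattice surface (Veech surface) if its Veech group, i.e. the group of derivatives of orientation-preserving affine self-homeomorphisms of $M$ preserving $\Sigma$, is a lattice in $SL(2,\mathbb{R})$. A lattice surface is square-tiled (arithmetic) if, after applying some element of $GL(2,\mathbb{R})$ to the translation charts, it is tiled by finitely many $1\times 1$ squares, i.e. it is a finite translation cover of $\mathbb{R}^2/\mathbb{Z}^2$ branched only over the point $(0,0)$, with $\Sigma$ contained in the preimage of $(0,0)$. A subset $A\subset\mathbb{R}^2$ is relatively dense in $\mathbb{R}^2$ if there is $R>0$ such that any Euclidean ball of radius $R$ in $\mathbb{R}^2$ contains at least one point of $A$. *)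

theory Defs
  imports "HOL-Analysis.Analysis" "HOL-Algebra.Group"
begin

section \<open>Translation surfaces\<close>

text \<open>A chart is a pair of an open set of regular points and a map defined on it; the values of
  the map outside of the open set are irrelevant.\<close>

record 'a flat_surface =
  surf :: "'a topology"
  sing :: "'a set"
  charts :: "('a set \<times> ('a \<Rightarrow> real^2)) set"

definition to_complex :: "real^2 \<Rightarrow> complex" where
  "to_complex x = Complex (x$1) (x$2)"

text \<open>Transition maps are translations on each connected component of the overlap, which is
  expressed by requiring them to be translations near every point of the overlap.\<close>

definition translation_atlas :: "'a flat_surface \<Rightarrow> bool" where
  "translation_atlas M \<longleftrightarrow>
     \<Union> (fst ` charts M) = topspace (surf M) - sing M \<and>
     (\<forall>(U, \<phi>) \<in> charts M.
        openin (surf M) U \<and> open (\<phi> ` U) \<and>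
        homeomorphic_map (subtopology (surf M) U) (top_of_set (\<phi> ` U)) \<phi>) \<and>
     (\<forall>(U, \<phi>) \<in> charts M. \<forall>(V, \<psi>) \<in> charts M. \<forall>x \<in> U \<inter> V.
        \<exists>c. \<forall>\<^sub>F y in nhdsin (surf M) x. \<psi> y = \<phi> y + c)"

text \<open>The cone of angle \<open>2 * pi * k\<close> is the \<open>k\<close>-fold cyclic cover of a disc branched over its
  centre. It is modelled by a disc with coordinate \<open>w\<close>, whose translation charts away from the
  apex are the local branches of \<open>w ^ k + c\<close>.\<close>

definition cone_point :: "'a flat_surface \<Rightarrow> nat \<Rightarrow> 'a \<Rightarrow> bool" where
  "cone_point M k p \<longleftrightarrow>
     (\<exists>U w r. openin (surf M) U \<and> p \<in> U \<and> U \<inter> sing M = {p} \<and> r > 0 \<and>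
        homeomorphic_map (subtopology (surf M) U) (top_of_set (ball (0::complex) r)) w \<and>
        w p = 0 \<and>
        (\<forall>(V, \<phi>) \<in> charts M. \<forall>x \<in> U \<inter> V.
           \<exists>c. \<forall>\<^sub>F y in nhdsin (surf M) x. to_complex (\<phi> y) = w y ^ k + c))"

text \<open>The last disjunct is the flat torus with one marked point: without points of cone angle
  larger than \<open>2 * pi\<close> the surface is a torus.\<close>

definition translation_surface :: "'a flat_surface \<Rightarrow> bool" where
  "translation_surface M \<longleftrightarrow>
     compact_space (surf M) \<and> connected_space (surf M) \<and> Hausdorff_space (surf M) \<and>
     finite (sing M) \<and> sing M \<subseteq> topspace (surf M) \<and> translation_atlas M \<and>
     (sing M \<noteq> {} \<and> (\<forall>p \<in> sing M. \<exists>k\<ge>2. cone_point M k p) \<or>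
      (\<exists>p. sing M = {p} \<and> cone_point M 1 p))"


section \<open>Saddle connections\<close>

text \<open>The segment is parametrised over \<open>{0..1}\<close> at constant velocity \<open>v\<close>, so that developing it
  gives a segment from some \<open>x\<close> to \<open>x + v\<close>.\<close>

definition saddle_connection :: "'a flat_surface \<Rightarrow> (real \<Rightarrow> 'a) \<Rightarrow> real^2 \<Rightarrow> bool" where
  "saddle_connection M \<gamma> v \<longleftrightarrow>
     v \<noteq> 0 \<and> pathin (surf M) \<gamma> \<and> \<gamma> 0 \<in> sing M \<and> \<gamma> 1 \<in> sing M \<and>
     (\<forall>t \<in> {0<..<1}. \<gamma> t \<notin> sing M \<and>
        (\<forall>(U, \<phi>) \<in> charts M. \<gamma> t \<in> U \<longrightarrow>
           (\<forall>\<^sub>F s in nhds t. \<phi> (\<gamma> s) = \<phi> (\<gamma> t) + (s - t) *\<^sub>R v)))"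

definition holonomy_vectors :: "'a flat_surface \<Rightarrow> (real^2) set" where
  "holonomy_vectors M = {v. \<exists>\<gamma>. saddle_connection M \<gamma> v}"


section \<open>Lattice surfaces\<close>

definition veech_group :: "'a flat_surface \<Rightarrow> (real^2^2) set" where
  "veech_group M =
     {A. det A > 0 \<and>
        (\<exists>f. homeomorphic_map (surf M) (surf M) f \<and> f ` sing M = sing M \<and>
           (\<forall>(U, \<phi>) \<in> charts M. \<forall>(V, \<psi>) \<in> charts M. \<forall>x \<in> U. f x \<in> V \<longrightarrow>
              (\<exists>c. \<forall>\<^sub>F y in nhdsin (surf M) x. \<psi> (f y) = A *v \<phi> y + c)))}"

definition SL2R :: "(real^2^2) monoid" where
  "SL2R = \<lparr>carrier = {A. det A = 1}, mult = (**), one = mat 1\<rparr>"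

definition haar_measure_SL2R :: "(real^2^2) measure \<Rightarrow> bool" where
  "haar_measure_SL2R \<mu> \<longleftrightarrow>
     sets \<mu> = sets (restrict_space borel (carrier SL2R)) \<and>
     emeasure \<mu> (carrier SL2R) \<noteq> 0 \<and>
     (\<forall>K \<subseteq> carrier SL2R. compact K \<longrightarrow> emeasure \<mu> K < \<infinity>) \<and>
     (\<forall>g \<in> carrier SL2R. \<forall>B \<in> sets \<mu>. emeasure \<mu> ((\<lambda>h. g ** h) ` B) = emeasure \<mu> B)"

text \<open>The quotient by a discrete subgroup has finite volume iff some Borel set of finite Haar
  measure meets every coset.\<close>

definition lattice_in_SL2R :: "(real^2^2) set \<Rightarrow> bool" where
  "lattice_in_SL2R \<Gamma> \<longleftrightarrow>
     subgroup \<Gamma> SL2R \<and> discrete \<Gamma> \<and>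
     (\<exists>\<mu> B. haar_measure_SL2R \<mu> \<and> B \<in> sets \<mu> \<and> emeasure \<mu> B < \<infinity> \<and>
        {h ** g | h g. h \<in> B \<and> g \<in> \<Gamma>} = carrier SL2R)"

definition lattice_surface :: "'a flat_surface \<Rightarrow> bool" where
  "lattice_surface M \<longleftrightarrow> translation_surface M \<and> lattice_in_SL2R (veech_group M)"


section \<open>Square-tiled surfaces\<close>

definition torus_proj :: "real^2 \<Rightarrow> (real^2) set" where
  "torus_proj x = {y. \<forall>i. y $ i - x $ i \<in> \<int>}"

definition torus :: "(real^2) set topology" where
  "torus = topology (\<lambda>V. V \<subseteq> range torus_proj \<and> open (torus_proj -` V))"

lemma openin_torus: "openin torus V \<longleftrightarrow> V \<subseteq> range torus_proj \<and> open (torus_proj -` V)"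
proof -
  have "istopology (\<lambda>V. V \<subseteq> range torus_proj \<and> open (torus_proj -` V))"
    unfolding istopology_def by (auto simp: vimage_Union intro: open_Int)
  then show ?thesis
    unfolding torus_def by (simp add: topology_inverse')
qed

lemma topspace_torus: "topspace torus = range torus_proj"
proof
  show "topspace torus \<subseteq> range torus_proj"
    unfolding topspace_def using openin_torus by blast
  have "openin torus (range torus_proj)"
    by (simp add: openin_torus vimage_def)
  then show "range torus_proj \<subseteq> topspace torus"
    by (rule openin_subset)
qed

lemma quotient_map_torus_proj: "quotient_map euclidean torus torus_proj"
  unfolding quotient_map_def by (auto simp: topspace_torus openin_torus vimage_def)

definition covering_map :: "'a topology \<Rightarrow> 'b topology \<Rightarrow> ('a \<Rightarrow> 'b) \<Rightarrow> bool" where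
  "covering_map X Y p \<longleftrightarrow>
     continuous_map X Y p \<and> p ` topspace X = topspace Y \<and>
     (\<forall>y \<in> topspace Y. \<exists>V. openin Y V \<and> y \<in> V \<and>
        (\<exists>\<U>. \<Union>\<U> = {x \<in> topspace X. p x \<in> V} \<and> pairwise disjnt \<U> \<and>
           (\<forall>U \<in> \<U>. openin X U \<and>
              homeomorphic_map (subtopology X U) (subtopology Y V) p)))"

text \<open>The charts of \<open>M\<close> cover all points outside of \<open>sing M\<close>, including those over the branch
  point, so the last clause says that \<open>p\<close> is locally a translation at all regular points.\<close>

definition torus_translation_cover :: "'a flat_surface \<Rightarrow> ('a \<Rightarrow> (real^2) set) \<Rightarrow> bool" where
  "torus_translation_cover M p \<longleftrightarrow>
     continuous_map (surf M) torus p \<and>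
     (\<forall>y \<in> topspace torus. finite {x \<in> topspace (surf M). p x = y}) \<and>
     covering_map (subtopology (surf M) {x. p x \<noteq> torus_proj 0})
       (subtopology torus (- {torus_proj 0})) p \<and>
     p ` sing M \<subseteq> {torus_proj 0} \<and>
     (\<forall>(U, \<phi>) \<in> charts M. \<forall>x \<in> U.
        \<exists>c. \<forall>\<^sub>F y in nhdsin (surf M) x. p y = torus_proj (\<phi> y + c))"

definition apply_linear :: "real^2^2 \<Rightarrow> 'a flat_surface \<Rightarrow> 'a flat_surface" where
  "apply_linear A M = M\<lparr>charts := (\<lambda>(U, \<phi>). (U, \<lambda>x. A *v \<phi> x)) ` charts M\<rparr>"

definition square_tiled :: "'a flat_surface \<Rightarrow> bool" where
  "square_tiled M \<longleftrightarrow>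
     (\<exists>A p. invertible A \<and> torus_translation_cover (apply_linear A M) p)"


section \<open>Relative density\<close>

definition relatively_dense :: "'a::metric_space set \<Rightarrow> bool" where
  "relatively_dense A \<longleftrightarrow> (\<exists>R>0. \<forall>x. ball x R \<inter> A \<noteq> {})"

end

theory Submission
  imports Defs "HOL-Number_Theory.Cong"
begin

text \<open>
  Let \<open>A\<close> and \<open>p\<close> make \<open>M\<close> square-tiled, and let \<open>N\<close> be the number of points of \<open>M\<close> over the
  branch point of the torus. The projection of a saddle connection with holonomy \<open>v\<close> is the
  straight closed path \<open>s \<mapsto> s (A v)\<close> in the torus, so \<open>A v\<close> is an integer vector. If an integer
  \<open>q\<close> divides both of its coordinates, then this path passes through the branch point at the times
  \<open>i / q\<close>. A saddle connection does not meet itself in its interior: the surface has a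
  well-defined direction field, so after a self-intersection the path would be periodic, also
  backwards in time, and its singular starting point would reappear in its interior. So the points
  at the times \<open>i / q\<close> with \<open>0 < i < q\<close> are different elements of the fibre, and \<open>q \<le> N + 1\<close>
  (lemma \<open>holonomy_common_divisor_le\<close>).

  Thus all of \<open>A ` holonomy_vectors M\<close> consists of integer vectors without common divisor greater
  than \<open>N + 1\<close>. By the Chinese remainder theorem there are arbitrarily large squares in which
  every integer point has a common prime divisor greater than \<open>N + 1\<close>
  (lemma \<open>square_of_large_common_divisors\<close>). The preimages of these squares under \<open>A\<close> contain
  arbitrarily large discs, and none of them contains a holonomy vector.
\<close>

section \<open>Saddle connections do not meet themselves\<close>

lemma pathin_near_in_open:
  assumes "pathin X \<gamma>" "openin X S" "t \<in> {0..1}" "\<gamma> t \<in> S"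
  obtains e where "e > 0" "\<And>s. s \<in> {0..1} \<Longrightarrow> \<bar>s - t\<bar> < e \<Longrightarrow> \<gamma> s \<in> S"
proof -
  have "openin (top_of_set {0..1}) {s \<in> {0..1}. \<gamma> s \<in> S}"
    using openin_continuous_map_preimage[of "top_of_set {0..1}" X \<gamma> S] assms(1,2)
    by (simp add: pathin_def)
  then obtain e where "e > 0" "ball t e \<inter> {0..1} \<subseteq> {s \<in> {0..1}. \<gamma> s \<in> S}"
    using assms(3,4) unfolding openin_contains_ball by blast
  then show ?thesis
    using that[of e] by (force simp: dist_real_def abs_minus_commute)
qed

lemma pathin_eventually_in_open:
  assumes "pathin X \<gamma>" "openin X S" "t \<in> {0<..<1}" "\<gamma> t \<in> S"
  shows "\<forall>\<^sub>F s in nhds t. \<gamma> s \<in> S"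
proof -
  obtain e where e: "e > 0" "\<And>s. s \<in> {0..1} \<Longrightarrow> \<bar>s - t\<bar> < e \<Longrightarrow> \<gamma> s \<in> S"
    using pathin_near_in_open[OF assms(1,2) _ assms(4)] assms(3)
    by (metis greaterThanLessThan_subseteq_atLeastAtMost_iff order_refl subsetD)
  have "\<forall>\<^sub>F s in nhds t. s \<in> {0<..<1}" "\<forall>\<^sub>F s in nhds t. s \<in> ball t e"
    using assms(3) e(1) by (intro eventually_nhds_in_open; simp)+
  then show ?thesis
    by eventually_elim (use e(2) in \<open>auto simp: dist_real_def abs_minus_commute\<close>)
qed

lemma pathin_in_topspace: "pathin X \<gamma> \<Longrightarrow> t \<in> {0..1} \<Longrightarrow> \<gamma> t \<in> topspace X"
  unfolding pathin_def continuous_map_def by auto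

lemma regular_point_in_chart:
  assumes "translation_atlas M" "x \<in> topspace (surf M)" "x \<notin> sing M"
  obtains U \<phi> where "(U, \<phi>) \<in> charts M" "x \<in> U"
proof -
  have "\<Union> (fst ` charts M) = topspace (surf M) - sing M"
    using assms(1) unfolding translation_atlas_def by (rule conjunct1)
  then have "x \<in> \<Union> (fst ` charts M)" using assms(2,3) by simp
  then show ?thesis using that by auto
qed

lemma filterlim_nhds_shift: "filterlim (\<lambda>s. s + d) (nhds (t + d)) (nhds (t::real))"
  by (intro tendsto_intros filterlim_ident)

text \<open>If a saddle connection met itself at the times \<open>a\<close> and \<open>a + d\<close>, then it would agree with its
  own shift by \<open>d\<close> on an open and closed set of times: open because both paths have the same
  constant velocity in any chart, and closed because the surface is Hausdorff.\<close>

lemma saddle_connection_inj_on: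
  assumes M: "translation_surface M" and \<gamma>: "saddle_connection M \<gamma> v"
  shows "inj_on \<gamma> {0<..<1}"
proof (rule linorder_inj_onI')
  fix a b :: real
  assume ab: "a \<in> {0<..<1}" "b \<in> {0<..<1}" "a < b"
  define d where "d = b - a"
  have d: "0 < d" "d < 1" using ab by (auto simp: d_def)
  have path: "pathin (surf M) \<gamma>"
    and line: "\<And>t U \<phi>. t \<in> {0<..<1} \<Longrightarrow> (U, \<phi>) \<in> charts M \<Longrightarrow> \<gamma> t \<in> U \<Longrightarrow>
      \<forall>\<^sub>F s in nhds t. \<phi> (\<gamma> s) = \<phi> (\<gamma> t) + (s - t) *\<^sub>R v"
    and reg: "\<And>t. t \<in> {0<..<1} \<Longrightarrow> \<gamma> t \<notin> sing M" and start: "\<gamma> 0 \<in> sing M"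
    using \<gamma> unfolding saddle_connection_def by blast+
  have haus: "Hausdorff_space (surf M)" and atlas: "translation_atlas M"
    using M by (auto simp: translation_surface_def)
  have local_const: "\<forall>\<^sub>F s in nhds t. (\<gamma> t = \<gamma> (t + d)) = (\<gamma> s = \<gamma> (s + d))"
    if t: "t \<in> {0<..<1 - d}" for t
  proof (cases "\<gamma> t = \<gamma> (t + d)")
    case True
    have t01: "t \<in> {0<..<1}" "t + d \<in> {0<..<1}" using t d by auto
    have "\<gamma> t \<in> topspace (surf M)"
      using t01 by (auto intro!: pathin_in_topspace[OF path])
    then obtain U \<phi> where U: "(U, \<phi>) \<in> charts M" "\<gamma> t \<in> U"
      using regular_point_in_chart[OF atlas] reg[OF t01(1)] by metis
    then have opU: "openin (surf M) U"
      and hom: "homeomorphic_map (subtopology (surf M) U) (top_of_set (\<phi> ` U)) \<phi>"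
      using atlas unfolding translation_atlas_def by blast+
    have "inj_on \<phi> U"
      using homeomorphic_imp_injective_map[OF hom] openin_subset[OF opU]
      by (simp add: inf_absorb2)
    have "\<forall>\<^sub>F s in nhds t. \<phi> (\<gamma> s) = \<phi> (\<gamma> t) + (s - t) *\<^sub>R v" "\<forall>\<^sub>F s in nhds t. \<gamma> s \<in> U"
      using line[OF t01(1) U] pathin_eventually_in_open[OF path opU t01(1) U(2)] by auto
    moreover have "\<forall>\<^sub>F s in nhds t.
        \<phi> (\<gamma> (s + d)) = \<phi> (\<gamma> (t + d)) + ((s + d) - (t + d)) *\<^sub>R v"
      using line[OF t01(2) U(1)] U(2) True
      by (intro eventually_compose_filterlim[OF _ filterlim_nhds_shift]) auto
    moreover have "\<forall>\<^sub>F s in nhds t. \<gamma> (s + d) \<in> U"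
      using pathin_eventually_in_open[OF path opU t01(2)] U(2) True
      by (intro eventually_compose_filterlim[OF _ filterlim_nhds_shift]) auto
    ultimately show ?thesis
      by eventually_elim (use True inj_onD[OF \<open>inj_on \<phi> U\<close>] in simp)
  next
    case False
    have t01: "t \<in> {0<..<1}" "t + d \<in> {0<..<1}" using t d by auto
    then have "\<gamma> t \<in> topspace (surf M)" "\<gamma> (t + d) \<in> topspace (surf M)"
      by (auto intro!: pathin_in_topspace[OF path])
    then obtain S T where ST: "openin (surf M) S" "openin (surf M) T" "\<gamma> t \<in> S" "\<gamma> (t + d) \<in> T"
      "disjnt S T"
      using haus False unfolding Hausdorff_space_def by metis
    have "\<forall>\<^sub>F s in nhds t. \<gamma> s \<in> S"
      by (rule pathin_eventually_in_open[OF path ST(1) t01(1) ST(3)])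
    moreover have "\<forall>\<^sub>F s in nhds t. \<gamma> (s + d) \<in> T"
      by (rule eventually_compose_filterlim[OF _ filterlim_nhds_shift])
        (rule pathin_eventually_in_open[OF path ST(2) t01(2) ST(4)])
    ultimately show ?thesis
      by eventually_elim (use False ST(5) in \<open>auto simp: disjnt_iff\<close>)
  qed
  show "\<gamma> a \<noteq> \<gamma> b"
  proof
    assume eq: "\<gamma> a = \<gamma> b"
    have shift: "\<gamma> s = \<gamma> (s + d)" if "s \<in> {0<..<1 - d}" for s
    proof -
      have "(\<gamma> a = \<gamma> (a + d)) = (\<gamma> s = \<gamma> (s + d))"
      proof (rule connected_local_const[where A = "{0<..<1 - d}"])
        show "a \<in> {0<..<1 - d}" using ab by (auto simp: d_def)
        show "\<forall>t\<in>{0<..<1 - d}. \<forall>\<^sub>F s in at t within {0<..<1 - d}.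
            (\<gamma> t = \<gamma> (t + d)) = (\<gamma> s = \<gamma> (s + d))"
          by (intro ballI filter_leD[OF at_within_le_nhds local_const])
      qed (use that in auto)
      then show ?thesis using eq by (simp add: d_def)
    qed
    have "\<gamma> 0 \<noteq> \<gamma> d" using start reg[of d] d by auto
    moreover have "\<gamma> 0 \<in> topspace (surf M)" "\<gamma> d \<in> topspace (surf M)"
      using d by (auto intro!: pathin_in_topspace[OF path])
    ultimately obtain S T where ST: "openin (surf M) S" "openin (surf M) T" "\<gamma> 0 \<in> S" "\<gamma> d \<in> T"
      "disjnt S T"
      using haus unfolding Hausdorff_space_def by metis
    obtain e1 where e1: "e1 > 0" "\<And>s. s \<in> {0..1} \<Longrightarrow> \<bar>s - 0\<bar> < e1 \<Longrightarrow> \<gamma> s \<in> S"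
      using pathin_near_in_open[OF path ST(1) _ ST(3)] by auto
    obtain e2 where e2: "e2 > 0" "\<And>s. s \<in> {0..1} \<Longrightarrow> \<bar>s - d\<bar> < e2 \<Longrightarrow> \<gamma> s \<in> T"
      using pathin_near_in_open[OF path ST(2) _ ST(4)] d by auto
    define s where "s = min (min e1 e2) (1 - d) / 2"
    have "0 < s" "s < e1" "s < e2" "s < 1 - d" using e1(1) e2(1) d by (auto simp: s_def)
    then have "\<gamma> s \<in> S" "\<gamma> (s + d) \<in> T" "\<gamma> s = \<gamma> (s + d)"
      using e1(2)[of s] e2(2)[of "s + d"] shift[of s] d by auto
    then show False using ST(5) by (auto simp: disjnt_iff)
  qed
qed


section \<open>Projection of saddle connections to the torus\<close>

lemma torus_proj_eq_iff: "torus_proj x = torus_proj y \<longleftrightarrow> (\<forall>i. x $ i - y $ i \<in> \<int>)"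
proof
  assume "torus_proj x = torus_proj y"
  moreover have "x \<in> torus_proj x" by (simp add: torus_proj_def)
  ultimately show "\<forall>i. x $ i - y $ i \<in> \<int>" by (auto simp: torus_proj_def)
next
  assume *: "\<forall>i. x $ i - y $ i \<in> \<int>"
  have "z $ i - x $ i \<in> \<int> \<longleftrightarrow> z $ i - y $ i \<in> \<int>" for z i
    using Ints_add[of "z $ i - x $ i" "x $ i - y $ i"]
      Ints_diff[of "z $ i - y $ i" "x $ i - y $ i"] * by auto
  then show "torus_proj x = torus_proj y" by (simp add: torus_proj_def)
qed

text \<open>The coordinate characters turn questions about the quotient topology of the torus into
  questions about continuous complex-valued functions.\<close>

definition torus_character :: "2 \<Rightarrow> (real^2) set \<Rightarrow> complex" where
  "torus_character i S = cis (2 * pi * (SOME y. y \<in> S) $ i)"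

lemma cis_2pi_eq_iff: "cis (2 * pi * x) = cis (2 * pi * y) \<longleftrightarrow> x - y \<in> \<int>"
proof -
  have "cis (2 * pi * x) = cis (2 * pi * y) \<longleftrightarrow> (\<exists>n::int. 2 * pi * x = 2 * pi * y + 2 * pi * n)"
    by (simp add: cis_conv_exp exp_eq) (simp add: complex_eq_iff algebra_simps)
  also have "\<dots> \<longleftrightarrow> (\<exists>n::int. x = y + n)"
    by (simp flip: distrib_left)
  also have "\<dots> \<longleftrightarrow> x - y \<in> \<int>"
    by (auto simp: Ints_def algebra_simps)
  finally show ?thesis .
qed

lemma torus_character_proj: "torus_character i (torus_proj x) = cis (2 * pi * x $ i)"
proof -
  have "x \<in> torus_proj x" by (simp add: torus_proj_def)
  then have "(SOME y. y \<in> torus_proj x) \<in> torus_proj x" by (rule someI)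
  then show ?thesis by (simp add: torus_character_def cis_2pi_eq_iff torus_proj_def)
qed

lemma continuous_map_torus_character: "continuous_map torus euclidean (torus_character i)"
proof (rule continuous_compose_quotient_map[OF quotient_map_torus_proj])
  show "continuous_map euclidean euclidean (torus_character i \<circ> torus_proj)"
    by (simp add: o_def torus_character_proj) (intro continuous_intros)
qed

lemma torus_proj_eq_characterI:
  "(\<And>i. torus_character i (torus_proj x) = torus_character i (torus_proj y)) \<Longrightarrow>
    torus_proj x = torus_proj y"
  by (simp add: torus_character_proj cis_2pi_eq_iff torus_proj_eq_iff)

text \<open>Dividing a character of the projected path by the character of the expected line gives a
  function that is locally constant at the interior times and continuous up to the endpoints.\<close>

lemma saddle_connection_torus_proj:
  assumes M: "translation_surface M" and \<gamma>: "saddle_connection M \<gamma> v"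
    and p: "torus_translation_cover (apply_linear A M) p"
    and t: "t \<in> {0..1}"
  shows "p (\<gamma> t) = torus_proj (t *\<^sub>R (A *v v))"
proof -
  define w where "w = A *v v"
  have path: "pathin (surf M) \<gamma>" and start: "\<gamma> 0 \<in> sing M"
    and line: "\<And>t U \<phi>. t \<in> {0<..<1} \<Longrightarrow> (U, \<phi>) \<in> charts M \<Longrightarrow> \<gamma> t \<in> U \<Longrightarrow>
      \<forall>\<^sub>F s in nhds t. \<phi> (\<gamma> s) = \<phi> (\<gamma> t) + (s - t) *\<^sub>R v"
    and reg: "\<And>t. t \<in> {0<..<1} \<Longrightarrow> \<gamma> t \<notin> sing M"
    using \<gamma> unfolding saddle_connection_def by blast+
  have atlas: "translation_atlas M"
    using M by (auto simp: translation_surface_def)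
  have p_cont: "continuous_map (surf M) torus p" and p_sing: "p ` sing M \<subseteq> {torus_proj 0}"
    using p by (auto simp: torus_translation_cover_def apply_linear_def)
  have p_chart: "\<exists>c. \<forall>\<^sub>F y in nhdsin (surf M) x. p y = torus_proj (A *v \<phi> y + c)"
    if "(U, \<phi>) \<in> charts M" "x \<in> U" for U \<phi> x
    using p that unfolding torus_translation_cover_def apply_linear_def by fastforce
  define f where "f i s = torus_character i (p (\<gamma> s)) / cis (2 * pi * (s *\<^sub>R w) $ i)" for i s
  have f_cont: "continuous_on {0..1} (f i)" for i
  proof -
    have "continuous_map (top_of_set {0..1}) euclidean (torus_character i \<circ> (p \<circ> \<gamma>))"
      using path p_cont unfolding pathin_def
      by (intro continuous_map_compose[OF _ continuous_map_torus_character]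
          continuous_map_compose[where X' = "surf M"])
    then show ?thesis
      unfolding f_def by (auto simp: o_def intro!: continuous_intros)
  qed
  have f_local: "\<forall>\<^sub>F s in nhds t. f i t = f i s" if t: "t \<in> {0<..<1}" for t i
  proof -
    have top: "\<gamma> t \<in> topspace (surf M)"
      using pathin_in_topspace[OF path, of t] t by auto
    then obtain U \<phi> where U: "(U, \<phi>) \<in> charts M" "\<gamma> t \<in> U"
      using regular_point_in_chart[OF atlas] reg[OF t] by metis
    obtain c where "\<forall>\<^sub>F y in nhdsin (surf M) (\<gamma> t). p y = torus_proj (A *v \<phi> y + c)"
      using p_chart[OF U] by blast
    then obtain S where S: "openin (surf M) S" "\<gamma> t \<in> S"
      "\<And>y. y \<in> S \<Longrightarrow> p y = torus_proj (A *v \<phi> y + c)"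
      using top by (auto simp: eventually_nhdsin)
    have "\<forall>\<^sub>F s in nhds t. \<gamma> s \<in> S"
      by (rule pathin_eventually_in_open[OF path S(1) t S(2)])
    moreover have "\<forall>\<^sub>F s in nhds t. \<phi> (\<gamma> s) = \<phi> (\<gamma> t) + (s - t) *\<^sub>R v"
      by (rule line[OF t U])
    ultimately show ?thesis
    proof eventually_elim
      case (elim s)
      have "A *v \<phi> (\<gamma> s) = A *v \<phi> (\<gamma> t) + (s - t) *\<^sub>R w"
        using elim(2) by (simp add: w_def matrix_vector_right_distrib
            linear_scale[OF matrix_vector_mul_linear])
      then have "p (\<gamma> s) = torus_proj (A *v \<phi> (\<gamma> t) + (s - t) *\<^sub>R w + c)"
        using S(3)[OF elim(1)] by simp
      then show ?case
        using S(3)[OF S(2)]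
        by (simp add: f_def torus_character_proj cis_divide algebra_simps)
    qed
  qed
  have f_1: "f i s = 1" if "s \<in> {0..1}" for i s
  proof -
    have "f i s = f i (1/2)" if "s \<in> {0<..<1}" for s
    proof (rule connected_local_const[where A = "{0<..<1}" and f = "f i"])
      show "\<forall>t\<in>{0<..<1}. \<forall>\<^sub>F s in at t within {0<..<1}. f i t = f i s"
        by (intro ballI filter_leD[OF at_within_le_nhds f_local])
    qed (use that in auto)
    moreover have "closure {0<..<1} = {0..1::real}"
      by (simp add: closure_greaterThanLessThan)
    ultimately have "f i s = f i (1/2)" if "s \<in> {0..1}" for s
      using continuous_constant_on_closure[of "{0<..<1}" "f i" "f i (1/2)" s] f_cont[of i] that
      by metis
    moreover have "f i 0 = 1"
      using start p_sing by (auto simp: f_def image_subset_iff torus_character_proj)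
    ultimately show ?thesis using that by (metis atLeastAtMost_iff order_refl zero_le_one)
  qed
  have "p (\<gamma> t) \<in> topspace torus"
    using pathin_in_topspace[OF path t] p_cont by (auto simp: continuous_map_def)
  then obtain x where x: "p (\<gamma> t) = torus_proj x" by (auto simp: topspace_torus)
  have "torus_proj x = torus_proj (t *\<^sub>R w)"
  proof (rule torus_proj_eq_characterI)
    show "torus_character i (torus_proj x) = torus_character i (torus_proj (t *\<^sub>R w))" for i
      using f_1[OF t, of i] x by (simp add: f_def torus_character_proj)
  qed
  then show ?thesis by (simp add: x w_def)
qed

lemma holonomy_Ints:
  assumes "translation_surface M" and "v \<in> holonomy_vectors M"
    and p: "torus_translation_cover (apply_linear A M) p"
  shows "(A *v v) $ i \<in> \<int>"
proof -
  obtain \<gamma> where \<gamma>: "saddle_connection M \<gamma> v"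
    using assms(2) by (auto simp: holonomy_vectors_def)
  have "p (\<gamma> 1) = torus_proj 0"
    using \<gamma> p by (auto simp: saddle_connection_def torus_translation_cover_def apply_linear_def)
  then have "torus_proj (A *v v) = torus_proj 0"
    using saddle_connection_torus_proj[OF assms(1) \<gamma> p, of 1] by simp
  then show ?thesis by (simp add: torus_proj_eq_iff)
qed

lemma holonomy_common_divisor_le:
  fixes q :: nat
  assumes M: "translation_surface M" and v: "v \<in> holonomy_vectors M"
    and p: "torus_translation_cover (apply_linear A M) p"
    and q: "\<And>i. (A *v v) $ i / q \<in> \<int>"
  shows "q \<le> card {x \<in> topspace (surf M). p x = torus_proj 0} + 1"
proof (cases "q = 0")
  case False
  let ?F = "{x \<in> topspace (surf M). p x = torus_proj 0}"
  obtain \<gamma> where \<gamma>: "saddle_connection M \<gamma> v"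
    using v by (auto simp: holonomy_vectors_def)
  have path: "pathin (surf M) \<gamma>" using \<gamma> by (simp add: saddle_connection_def)
  have "torus_proj 0 \<in> topspace torus" by (simp add: topspace_torus)
  then have fin: "finite ?F"
    using p by (auto simp: torus_translation_cover_def apply_linear_def)
  have time: "real k / q \<in> {0<..<1}" if "k \<in> {1..<q}" for k
    using that by auto
  have "inj_on (\<gamma> \<circ> (\<lambda>k. real k / q)) {1..<q}"
  proof (rule comp_inj_on)
    show "inj_on (\<lambda>k. real k / q) {1..<q}" using False by (auto simp: inj_on_def)
    show "inj_on \<gamma> ((\<lambda>k. real k / q) ` {1..<q})"
      using time by (intro inj_on_subset[OF saddle_connection_inj_on[OF M \<gamma>]]) auto
  qed
  moreover have "(\<gamma> \<circ> (\<lambda>k. real k / q)) ` {1..<q} \<subseteq> ?F"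
  proof clarify
    fix k assume k: "k \<in> {1..<q}"
    have t: "real k / q \<in> {0..1}" using time[OF k] by auto
    have "real k * ((A *v v) $ i / q) \<in> \<int>" for i by (intro Ints_mult q) auto
    then have "torus_proj ((real k / q) *\<^sub>R (A *v v)) = torus_proj 0"
      by (simp add: torus_proj_eq_iff)
    then show "(\<gamma> \<circ> (\<lambda>k. real k / q)) k \<in> topspace (surf M) \<and>
        p ((\<gamma> \<circ> (\<lambda>k. real k / q)) k) = torus_proj 0"
      using pathin_in_topspace[OF path t] saddle_connection_torus_proj[OF M \<gamma> p t] by simp
  qed
  ultimately have "card {1..<q} \<le> card ?F"
    using fin by (rule card_inj_on_le)
  then show ?thesis by simp
qed simp


section \<open>Squares without visible points\<close>

text \<open>Choose different primes greater than \<open>N\<close> for all positions in the square, and solve one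
  congruence for each position and each coordinate.\<close>

lemma square_of_large_common_divisors:
  fixes N K :: nat
  obtains X Y :: int where
    "\<And>a b. a \<in> {X - K..X} \<Longrightarrow> b \<in> {Y - K..Y} \<Longrightarrow> \<exists>q::nat. q > N \<and> int q dvd a \<and> int q dvd b"
proof -
  define P where "P = {q::nat. prime q \<and> q > N}"
  have "P = {q. prime q} - {..N}" by (auto simp: P_def)
  then have inf: "infinite P" by (simp add: primes_infinite Diff_infinite_finite)
  define m where "m = (\<lambda>ij. enumerate P (prod_encode ij))"
  have mP: "prime (m ij)" "m ij > N" for ij
    using enumerate_in_set[OF inf] by (auto simp: m_def P_def)
  have m_eq: "m ij = m kl \<longleftrightarrow> ij = kl" for ij kl
    using strict_mono_eq[OF strict_mono_enumerate[OF inf]] by (simp add: m_def prod_encode_eq)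
  have cop: "\<forall>ij\<in>{..K} \<times> {..K}. \<forall>kl\<in>{..K} \<times> {..K}. ij \<noteq> kl \<longrightarrow> coprime (m ij) (m kl)"
    using mP m_eq by (auto intro!: primes_coprime)
  obtain X where X: "\<forall>ij\<in>{..K} \<times> {..K}. [X = fst ij] (mod m ij)"
    using chinese_remainder_nat[OF _ cop, of fst] by auto
  obtain Y where Y: "\<forall>ij\<in>{..K} \<times> {..K}. [Y = snd ij] (mod m ij)"
    using chinese_remainder_nat[OF _ cop, of snd] by auto
  show ?thesis
  proof (rule that[of "int X" "int Y"])
    fix a b assume ab: "a \<in> {int X - K..X}" "b \<in> {int Y - K..Y}"
    define i j where "i = nat (X - a)" and "j = nat (Y - b)"
    have ij: "(i, j) \<in> {..K} \<times> {..K}" "a = int X - int i" "b = int Y - int j"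
      using ab by (auto simp: i_def j_def)
    have "[int X = int i] (mod int (m (i, j)))" "[int Y = int j] (mod int (m (i, j)))"
      using X Y ij(1) by (auto simp: cong_int_iff)
    then have "int (m (i, j)) dvd a" "int (m (i, j)) dvd b"
      by (simp_all add: ij cong_iff_dvd_diff)
    then show "\<exists>q::nat. q > N \<and> int q dvd a \<and> int q dvd b"
      using mP(2) by blast
  qed
qed


section \<open>Gaps between the holonomy vectors\<close>

theorem theorem4:
  fixes M :: "'a flat_surface"
  assumes "lattice_surface M" and "square_tiled M"
  shows "\<not> relatively_dense (holonomy_vectors M)"
proof
  assume "relatively_dense (holonomy_vectors M)"
  then obtain R where R: "R > 0" "\<And>x. ball x R \<inter> holonomy_vectors M \<noteq> {}"
    by (auto simp: relatively_dense_def)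
  have M: "translation_surface M" using assms(1) by (simp add: lattice_surface_def)
  obtain A p where A: "invertible A" and p: "torus_translation_cover (apply_linear A M) p"
    using assms(2) by (auto simp: square_tiled_def)
  obtain B where B: "B > 0" "\<And>x. norm (A *v x) \<le> norm x * B"
    using bounded_linear.pos_bounded[OF matrix_vector_mul_bounded_linear[of A]] by blast
  define N where "N = card {x \<in> topspace (surf M). p x = torus_proj 0} + 1"
  define K where "K = nat \<lceil>2 * (R * B)\<rceil>"
  have K: "2 * (R * B) \<le> K" unfolding K_def by linarith
  obtain X Y :: int where XY:
    "\<And>a b. a \<in> {X - K..X} \<Longrightarrow> b \<in> {Y - K..Y} \<Longrightarrow> \<exists>q::nat. q > N \<and> int q dvd a \<and> int q dvd b"
    using square_of_large_common_divisors[of K N] by blast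
  \<comment> \<open>The disc of radius \<open>R\<close> around the preimage of the centre \<open>z\<close> of the square is mapped into the
    square, since \<open>A\<close> stretches by at most \<open>B\<close> and the side \<open>K\<close> is at least \<open>2 R B\<close>.\<close>
  define z :: "real^2" where "z = vector [X - K / 2, Y - K / 2]"
  obtain x where x: "A *v x = z"
    using A by (metis invertible_def matrix_vector_mul_assoc matrix_vector_mul_lid)
  obtain v where v: "v \<in> holonomy_vectors M" "dist x v < R" using R(2)[of x] by auto
  have close: "\<bar>(A *v v) $ i - z $ i\<bar> \<le> K / 2" for i
  proof -
    have "\<bar>(A *v v) $ i - z $ i\<bar> = \<bar>(A *v (v - x)) $ i\<bar>"
      by (simp add: x matrix_vector_mult_diff_distrib)
    also have "\<dots> \<le> norm (A *v (v - x))" by (rule component_le_norm_cart)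
    also have "\<dots> \<le> norm (v - x) * B" by (rule B)
    also have "\<dots> \<le> R * B"
      using v(2) B(1) by (intro mult_right_mono) (auto simp: dist_norm norm_minus_commute)
    finally show ?thesis using K by simp
  qed
  obtain a b :: int where ab: "(A *v v) $ 1 = a" "(A *v v) $ 2 = b"
    using holonomy_Ints[OF M v(1) p] by (meson Ints_cases)
  have "a \<in> {X - K..X}" "b \<in> {Y - K..Y}"
    using close[of 1, unfolded ab z_def vector_2] close[of 2, unfolded ab z_def vector_2]
    by (auto simp only: atLeastAtMost_iff)
  then obtain q :: nat where q: "q > N" "int q dvd a" "int q dvd b"
    using XY by blast
  have "(A *v v) $ i / q \<in> \<int>" for i
  proof -
    have "real_of_int c / q \<in> \<int>" if "int q dvd c" for c
      using that q(1) by auto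
    then show ?thesis using q(2,3) ab exhaust_2[of i] by auto
  qed
  then have "q \<le> N"
    using holonomy_common_divisor_le[OF M v(1) p] unfolding N_def by blast
  then show False using q(1) by simp
qed

end
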